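(* The theory CC$''$ weakly interprets intuitionistic second order Peano arithmetic minus the induction axiom; that is, for every theorem $\varphi$ of that theory there is a theorem $\psi$ of CC$''$ such that deleting every occurrence of $\Box$ from $\psi$ yields $\varphi$.
   Context: CC is the following system. Its language is the language of set theory ($\in$, $=$) augmented by a unary operator $\Box$, with formulas closed under $\wedge,\vee,\to,\forall,\exists$ and under $A\mapsto\Box A$; $\bot$ abbreviates $(\forall x)(\forall y)(x\in y)$ and $\neg A$ abbreviates $A\to\bot$. Its axioms and rules are those of intuitionistic predicate calculus with equality, plus: $A\to\Box A$; $\Box(A\wedge B)\leftrightarrow(\Box A\wedge\Box B)$; $\Box(A\vee B)\leftrightarrow(\Box A\vee\Box B)$; $\Box((\exists x)A)\leftrightarrow(\exists x)\Box A$; $\Box((\forall x)A)\leftrightarrow(\forall x)\Box A$; $\Box(A\to B)\to(\Box A\to\Box B)$; the rule "from $\Box A$ infer $A$"; extensionality $x=y\leftrightarrow(\forall u)(u\in x\leftrightarrow u\in y)$; and the comprehension scheme $(\exists x)(\forall r)(r\in x\leftrightarrow\Box A)$ for a fixed variable $r$, any variable $x$, and any formula $A$ in which $x$ is not free. CC$''$ is the extension of CC by definitions obtained by adding a constant $0$ with axiom $r\in 0\leftrightarrow\Box\bot$, a unary function symbol $S$ with axiom $r\in Sx\leftrightarrow\Box(r=x)$, and a constant $\omega$ with axiom $r\in\omega\leftrightarrow\Box(\forall z)[(0\in z\wedge(\forall x)(x\in z\to Sx\in z))\to r\in z]$. Intuitionistic second order Peano arithmetic minus induction is here understood in the same language minus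 $\Box$ (symbols $\in,=,0,S,\omega$, the natural numbers being the members of $\omega$), over intuitionistic logic, with the axioms $0\in\omega$; $x\in\omega\to Sx\in\omega$; $\neg(Sx=0)$; $Sx=Sy\to x=y$. A theory $\mathcal{T}_2$ in a language with $\Box$ weakly interprets a theory $\mathcal{T}_1$ in the same language without $\Box$ if every theorem of $\mathcal{T}_1$ is obtained from some theorem of $\mathcal{T}_2$ by deleting all boxes. *)

theory Defs
  imports Main
begin

text \<open>Terms of the language of CC'' (variables are natural numbers; the constants
  0, omega and the unary function symbol S come from the extension by definitions).\<close>
datatype trm = Var nat | Zero | Omega | Sc trm

datatype fm =
    Mem trm trm
  | Eq trm trm
  | Conj fm fm
  | Disj fm fm
  | Imp fm fm
  | All nat fm
  | Ex nat fm
  | Box fm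

definition Bot :: fm where
  "Bot = All 0 (All 1 (Mem (Var 0) (Var 1)))"

definition Neg :: "fm \<Rightarrow> fm" where
  "Neg A = Imp A Bot"

definition Iff :: "fm \<Rightarrow> fm \<Rightarrow> fm" where
  "Iff A B = Conj (Imp A B) (Imp B A)"

fun tvars :: "trm \<Rightarrow> nat set" where
  "tvars (Var x) = {x}"
| "tvars Zero = {}"
| "tvars Omega = {}"
| "tvars (Sc t) = tvars t"

fun fv :: "fm \<Rightarrow> nat set" where
  "fv (Mem s t) = tvars s \<union> tvars t"
| "fv (Eq s t) = tvars s \<union> tvars t"
| "fv (Conj A B) = fv A \<union> fv B"
| "fv (Disj A B) = fv A \<union> fv B"
| "fv (Imp A B) = fv A \<union> fv B"
| "fv (All x A) = fv A - {x}"
| "fv (Ex x A) = fv A - {x}"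
| "fv (Box A) = fv A"

fun tsubst :: "trm \<Rightarrow> nat \<Rightarrow> trm \<Rightarrow> trm" where
  "tsubst (Var y) x s = (if y = x then s else Var y)"
| "tsubst Zero x s = Zero"
| "tsubst Omega x s = Omega"
| "tsubst (Sc t) x s = Sc (tsubst t x s)"

fun subst :: "fm \<Rightarrow> nat \<Rightarrow> trm \<Rightarrow> fm" where
  "subst (Mem a b) x s = Mem (tsubst a x s) (tsubst b x s)"
| "subst (Eq a b) x s = Eq (tsubst a x s) (tsubst b x s)"
| "subst (Conj A B) x s = Conj (subst A x s) (subst B x s)"
| "subst (Disj A B) x s = Disj (subst A x s) (subst B x s)"
| "subst (Imp A B) x s = Imp (subst A x s) (subst B x s)"
| "subst (All y A) x s = (if y = x then All y A else All y (subst A x s))"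
| "subst (Ex y A) x s = (if y = x then Ex y A else Ex y (subst A x s))"
| "subst (Box A) x s = Box (subst A x s)"

fun free_for :: "trm \<Rightarrow> nat \<Rightarrow> fm \<Rightarrow> bool" where
  "free_for s x (Mem a b) = True"
| "free_for s x (Eq a b) = True"
| "free_for s x (Conj A B) = (free_for s x A \<and> free_for s x B)"
| "free_for s x (Disj A B) = (free_for s x A \<and> free_for s x B)"
| "free_for s x (Imp A B) = (free_for s x A \<and> free_for s x B)"
| "free_for s x (All y A) = (y = x \<or> x \<notin> fv A \<or> (y \<notin> tvars s \<and> free_for s x A))"
| "free_for s x (Ex y A) = (y = x \<or> x \<notin> fv A \<or> (y \<notin> tvars s \<and> free_for s x A))"
| "free_for s x (Box A) = free_for s x A"

fun boxfree :: "fm \<Rightarrow> bool" where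
  "boxfree (Mem a b) = True"
| "boxfree (Eq a b) = True"
| "boxfree (Conj A B) = (boxfree A \<and> boxfree B)"
| "boxfree (Disj A B) = (boxfree A \<and> boxfree B)"
| "boxfree (Imp A B) = (boxfree A \<and> boxfree B)"
| "boxfree (All y A) = boxfree A"
| "boxfree (Ex y A) = boxfree A"
| "boxfree (Box A) = False"

fun erase :: "fm \<Rightarrow> fm" where
  "erase (Mem a b) = Mem a b"
| "erase (Eq a b) = Eq a b"
| "erase (Conj A B) = Conj (erase A) (erase B)"
| "erase (Disj A B) = Disj (erase A) (erase B)"
| "erase (Imp A B) = Imp (erase A) (erase B)"
| "erase (All y A) = All y (erase A)"
| "erase (Ex y A) = Ex y (erase A)"
| "erase (Box A) = erase A"

inductive logax :: "fm \<Rightarrow> bool" where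
  ax1: "logax (Imp A (Imp B A))"
| ax2: "logax (Imp (Imp A (Imp B C)) (Imp (Imp A B) (Imp A C)))"
| ax3: "logax (Imp (Conj A B) A)"
| ax4: "logax (Imp (Conj A B) B)"
| ax5: "logax (Imp A (Imp B (Conj A B)))"
| ax6: "logax (Imp A (Disj A B))"
| ax7: "logax (Imp B (Disj A B))"
| ax8: "logax (Imp (Imp A C) (Imp (Imp B C) (Imp (Disj A B) C)))"
| efq: "logax (Imp Bot A)"
| allE: "free_for t x A \<Longrightarrow> logax (Imp (All x A) (subst A x t))"
| exI: "free_for t x A \<Longrightarrow> logax (Imp (subst A x t) (Ex x A))"
| eqrefl: "logax (Eq t t)"
| eqsubst: "free_for s z A \<Longrightarrow> free_for t z A \<Longrightarrow>
     logax (Imp (Eq s t) (Imp (subst A z s) (subst A z t)))"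

text \<open>The fixed comprehension variable r is variable 0.\<close>
definition rv :: nat where "rv = 0"

inductive ccax :: "fm \<Rightarrow> bool" where
  box_intro: "ccax (Imp A (Box A))"
| box_conj: "ccax (Iff (Box (Conj A B)) (Conj (Box A) (Box B)))"
| box_disj: "ccax (Iff (Box (Disj A B)) (Disj (Box A) (Box B)))"
| box_ex: "ccax (Iff (Box (Ex x A)) (Ex x (Box A)))"
| box_all: "ccax (Iff (Box (All x A)) (All x (Box A)))"
| box_K: "ccax (Imp (Box (Imp A B)) (Imp (Box A) (Box B)))"
| ext: "u \<noteq> x \<Longrightarrow> u \<noteq> y \<Longrightarrow>
     ccax (Iff (Eq (Var x) (Var y)) (All u (Iff (Mem (Var u) (Var x)) (Mem (Var u) (Var y)))))"
| compr: "x \<noteq> rv \<Longrightarrow> x \<notin> fv A \<Longrightarrow>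
     ccax (Ex x (All rv (Iff (Mem (Var rv) (Var x)) (Box A))))"
| def_zero: "ccax (Iff (Mem (Var rv) Zero) (Box Bot))"
| def_S: "x \<noteq> rv \<Longrightarrow> ccax (Iff (Mem (Var rv) (Sc (Var x))) (Box (Eq (Var rv) (Var x))))"
| def_omega: "x \<noteq> rv \<Longrightarrow> z \<noteq> rv \<Longrightarrow> x \<noteq> z \<Longrightarrow>
     ccax (Iff (Mem (Var rv) Omega)
       (Box (All z (Imp (Conj (Mem Zero (Var z))
                              (All x (Imp (Mem (Var x) (Var z)) (Mem (Sc (Var x)) (Var z)))))
                        (Mem (Var rv) (Var z))))))"

inductive CCpp :: "fm \<Rightarrow> bool" where
  logic: "logax A \<Longrightarrow> CCpp A"
| axiom: "ccax A \<Longrightarrow> CCpp A"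
| mp: "CCpp (Imp A B) \<Longrightarrow> CCpp A \<Longrightarrow> CCpp B"
| allR: "CCpp (Imp B A) \<Longrightarrow> x \<notin> fv B \<Longrightarrow> CCpp (Imp B (All x A))"
| exR: "CCpp (Imp A B) \<Longrightarrow> x \<notin> fv B \<Longrightarrow> CCpp (Imp (Ex x A) B)"
| boxE: "CCpp (Box A) \<Longrightarrow> CCpp A"

inductive paax :: "fm \<Rightarrow> bool" where
  zero_nat: "paax (Mem Zero Omega)"
| succ_nat: "paax (Imp (Mem (Var x) Omega) (Mem (Sc (Var x)) Omega))"
| succ_ne_zero: "paax (Neg (Eq (Sc (Var x)) Zero))"
| succ_inj: "paax (Imp (Eq (Sc (Var x)) (Sc (Var y))) (Eq (Var x) (Var y)))"

inductive PAmi :: "fm \<Rightarrow> bool" where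
  logic: "logax A \<Longrightarrow> boxfree A \<Longrightarrow> PAmi A"
| axiom: "paax A \<Longrightarrow> PAmi A"
| mp: "PAmi (Imp A B) \<Longrightarrow> PAmi A \<Longrightarrow> PAmi B"
| allR: "PAmi (Imp B A) \<Longrightarrow> x \<notin> fv B \<Longrightarrow> PAmi (Imp B (All x A))"
| exR: "PAmi (Imp A B) \<Longrightarrow> x \<notin> fv B \<Longrightarrow> PAmi (Imp (Ex x A) B)"

definition weakly_interprets :: "(fm \<Rightarrow> bool) \<Rightarrow> (fm \<Rightarrow> bool) \<Rightarrow> bool" where
  "weakly_interprets T2 T1 \<longleftrightarrow> (\<forall>\<phi>. T1 \<phi> \<longrightarrow> (\<exists>\<psi>. T2 \<psi> \<and> erase \<psi> = \<phi>))"

end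

(* Deleting boxes is compatible with modus ponens only if the two occurrences of the cut formula
   are boxed alike, and they are not: for a cut-free proof of G |- C one can box the positive atoms
   of the sequent k times, for some k, since the two arithmetical axioms that fail in CC'' become
   the rules Sx = 0 |- Box Bot and Sx = Sy |- Box (x = y).  Cuts are eliminated semantically, by a
   Kripke model in the manner of Okada.  Its worlds are sequences of formulas of CC'', the k-th
   entry being a context used with k boxes; an atom P is forced at a world g if g(k) entails
   Box^k P for almost all k, and weakening the context along g absorbs the extra boxes.  The model
   validates all theorems, and what it forces is provable in CC'' with positive atoms boxed. *)

theory Submission
  imports Defs Complex_Main
begin

section \<open>Intuitionistic entailment in CC''\<close>

text \<open>Since \<open>P\<close> entails \<open>Box P\<close>, boxing the positive atoms of a
  sequent only weakens it: goals become weaker, and hypotheses become stronger where the premises of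
  their implications are boxed. Those premises count as positive, so the translation of a hypothesis
  itself depends on \<open>k\<close>. This is why a world is a sequence of contexts, and why its
  later entries are stronger. Asking for almost all \<open>k\<close> rather than for some
  \<open>k\<close> lets finitely many facts share one \<open>k\<close> and tolerates the step from
  \<open>k\<close> to \<open>k + 1\<close> that an arithmetical rule costs. The obstacle is
  uniformity: a forced universal formula may have a different threshold for each of infinitely many
  terms. Only the threshold at one generic variable is used, a variable fresh for every entry of the
  world and, when a quantifier is eliminated, of the goal. Hence worlds and goals may contain only
  finitely many free variables in all.\<close>

definition ent :: "fm \<Rightarrow> fm \<Rightarrow> bool" (infix "\<turnstile>" 40) where
  "H \<turnstile> A \<longleftrightarrow> CCpp (Imp H A)"

lemma ent_thm: "CCpp A \<Longrightarrow> H \<turnstile> A"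
  unfolding ent_def by (meson CCpp.logic CCpp.mp ax1)

lemma ent_mp: "H \<turnstile> Imp A B \<Longrightarrow> H \<turnstile> A \<Longrightarrow> H \<turnstile> B"
  unfolding ent_def by (meson CCpp.logic CCpp.mp ax2)

lemma ent_refl [simp]: "A \<turnstile> A"
  by (meson CCpp.logic ax1 ent_def ent_mp)

lemma ent_trans [trans]: "A \<turnstile> B \<Longrightarrow> B \<turnstile> C \<Longrightarrow> A \<turnstile> C"
  by (meson ent_def ent_mp ent_thm)

lemma ent_conjI: "H \<turnstile> A \<Longrightarrow> H \<turnstile> B \<Longrightarrow> H \<turnstile> Conj A B"
  by (meson CCpp.logic ax5 ent_mp ent_thm)

lemma ent_conj1: "Conj A B \<turnstile> A"
  and ent_conj2: "Conj A B \<turnstile> B"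
  unfolding ent_def by (auto intro: CCpp.logic logax.intros)

lemma ent_impI: "Conj H A \<turnstile> B \<Longrightarrow> H \<turnstile> Imp A B"
  by (meson CCpp.logic ax2 ax5 ent_def ent_mp ent_thm)

lemma ent_impE: "H \<turnstile> Imp A B \<Longrightarrow> Conj H A \<turnstile> B"
  by (meson ent_conj1 ent_conj2 ent_mp ent_trans)

lemma ent_disj1: "A \<turnstile> Disj A B"
  and ent_disj2: "B \<turnstile> Disj A B"
  unfolding ent_def by (auto intro: CCpp.logic logax.intros)

lemma ent_disjE:
  assumes "Conj H A \<turnstile> C" "Conj H B \<turnstile> C" shows "Conj H (Disj A B) \<turnstile> C"
  by (meson CCpp.logic assms ax8 ent_impE ent_impI ent_mp ent_thm)

lemma ent_conj_mono: "A \<turnstile> A' \<Longrightarrow> B \<turnstile> B' \<Longrightarrow> Conj A B \<turnstile> Conj A' B'"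
  by (meson ent_conj1 ent_conj2 ent_conjI ent_trans)

lemma ent_conj_cong:
  assumes "H \<turnstile> Imp A A'" "H \<turnstile> Imp B B'" shows "H \<turnstile> Imp (Conj A B) (Conj A' B')"
proof (intro ent_impI ent_conjI)
  show "Conj H (Conj A B) \<turnstile> A'"
    using ent_trans[OF ent_conj_mono[OF ent_refl ent_conj1] ent_impE[OF assms(1)]] .
  show "Conj H (Conj A B) \<turnstile> B'"
    using ent_trans[OF ent_conj_mono[OF ent_refl ent_conj2] ent_impE[OF assms(2)]] .
qed

lemma ent_disj_cong:
  assumes "H \<turnstile> Imp A A'" "H \<turnstile> Imp B B'" shows "H \<turnstile> Imp (Disj A B) (Disj A' B')"
  using assms by (intro ent_impI ent_disjE) (metis ent_impE ent_trans ent_disj1 ent_disj2)+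

lemma ent_imp_cong:
  assumes "H \<turnstile> Imp A' A" "H \<turnstile> Imp B B'" shows "H \<turnstile> Imp (Imp A B) (Imp A' B')"
proof (intro ent_impI)
  let ?K = "Conj (Conj H (Imp A B)) A'"
  have H: "?K \<turnstile> H" by (meson ent_conj1 ent_trans)
  have "?K \<turnstile> A" by (rule ent_mp[OF ent_trans[OF H assms(1)] ent_conj2])
  then have "?K \<turnstile> B" by (rule ent_mp[OF ent_trans[OF ent_conj1 ent_conj2]])
  then show "?K \<turnstile> B'" by (rule ent_mp[OF ent_trans[OF H assms(2)]])
qed

lemma ent_swap: "H \<turnstile> Imp A B \<longleftrightarrow> A \<turnstile> Imp H B"
  by (meson ent_conj1 ent_conj2 ent_conjI ent_impE ent_impI ent_trans)

lemma ent_allI: "H \<turnstile> A \<Longrightarrow> x \<notin> fv H \<Longrightarrow> H \<turnstile> All x A"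
  unfolding ent_def by (rule CCpp.allR)

lemma ent_exE: "A \<turnstile> C \<Longrightarrow> x \<notin> fv C \<Longrightarrow> Ex x A \<turnstile> C"
  unfolding ent_def by (rule CCpp.exR)

lemma ent_allE: "free_for t x A \<Longrightarrow> All x A \<turnstile> subst A x t"
  unfolding ent_def by (intro CCpp.logic allE)

lemma ent_exI: "free_for t x A \<Longrightarrow> subst A x t \<turnstile> Ex x A"
  unfolding ent_def by (intro CCpp.logic exI)

lemma CCpp_ent: "H \<turnstile> A \<Longrightarrow> CCpp H \<Longrightarrow> CCpp A"
  unfolding ent_def by (rule CCpp.mp)

lemma CCpp_Iff:
  assumes "CCpp (Iff A B)" shows "A \<turnstile> B" "B \<turnstile> A"
  using CCpp_ent[OF ent_conj1] CCpp_ent[OF ent_conj2] assms unfolding Iff_def ent_def by blast+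

lemma tsubst_notin [simp]: "x \<notin> tvars t \<Longrightarrow> tsubst t x s = t"
  by (induction t) auto

lemma tsubst_Var [simp]: "tsubst t x (Var x) = t"
  by (induction t) auto

lemma subst_Var [simp]: "subst A x (Var x) = A"
  by (induction A) auto

lemma free_for_Var [simp]: "free_for (Var x) x A"
  by (induction A) auto

lemma CCpp_all: "CCpp A \<Longrightarrow> CCpp (All x A)"
  \<comment> \<open>A closed theorem as hypothesis turns the rule \<open>allR\<close> into plain
    generalization.\<close>
  by (rule CCpp_ent[OF ent_allI[of "Eq Zero Zero"]]) (simp_all add: ent_thm CCpp.logic eqrefl)

lemma CCpp_subst: "CCpp A \<Longrightarrow> free_for t x A \<Longrightarrow> CCpp (subst A x t)"
  by (meson CCpp_all CCpp_ent ent_allE)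

lemma finite_tvars [simp]: "finite (tvars t)"
  by (induction t) auto

lemma finite_fv [simp]: "finite (fv A)"
  by (induction A) auto

lemma fresh_nat: "finite (S :: nat set) \<Longrightarrow> \<exists>y. y \<notin> S"
  by (rule ex_new_if_finite) auto

section \<open>Boxes and equality\<close>

text \<open>\<open>box_intro\<close> applied to the theorem \<open>Imp A B\<close> acts as
  necessitation; \<open>box_K\<close> then distributes the box.\<close>

lemma box_mono: "A \<turnstile> B \<Longrightarrow> Box A \<turnstile> Box B"
  by (meson CCpp.axiom CCpp.mp box_K box_intro ent_def)

lemma ent_box: "A \<turnstile> Box A"
  unfolding ent_def by (intro CCpp.axiom box_intro)

definition boxn :: "nat \<Rightarrow> fm \<Rightarrow> fm" where
  "boxn k = Box ^^ k"

lemma boxn_0 [simp]: "boxn 0 A = A"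
  and boxn_Suc: "boxn (Suc k) A = Box (boxn k A)"
  by (auto simp: boxn_def)

lemma boxn_Suc': "boxn (Suc k) A = boxn k (Box A)"
  by (simp add: boxn_def funpow_swap1)

lemma fv_boxn [simp]: "fv (boxn k A) = fv A"
  by (induction k) (auto simp: boxn_Suc)

lemma erase_boxn [simp]: "erase (boxn k A) = erase A"
  by (induction k) (auto simp: boxn_Suc)

lemma boxn_mono: "A \<turnstile> B \<Longrightarrow> boxn k A \<turnstile> boxn k B"
  by (induction k) (auto simp: boxn_Suc intro: box_mono)

lemma boxn_mp: "H \<turnstile> boxn k (Imp A B) \<Longrightarrow> H \<turnstile> boxn k A \<Longrightarrow> H \<turnstile> boxn k B"
proof (induction k arbitrary: A B)
  case (Suc k)
  have "boxn k (Box (Imp A B)) \<turnstile> boxn k (Imp (Box A) (Box B))"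
    by (intro boxn_mono) (simp add: ent_def CCpp.axiom box_K)
  with Suc show ?case by (metis boxn_Suc' ent_trans)
qed (auto intro: ent_mp)

lemma ent_boxn: "A \<turnstile> boxn k A"
  by (induction k) (auto simp: boxn_Suc intro: ent_trans ent_box)

lemma boxn_le: assumes "k \<le> m" shows "boxn k A \<turnstile> boxn m A"
  using assms by (induction rule: dec_induct) (auto simp: boxn_Suc intro: ent_trans ent_box)

lemma boxn_ent_mp:
  assumes "A \<turnstile> Imp B C" "H \<turnstile> boxn k A" "H \<turnstile> boxn k B" shows "H \<turnstile> boxn k C"
  by (meson assms boxn_mono boxn_mp ent_trans)

text \<open>Barcan direction of \<open>box_all\<close>, iterated. A boxed atom can be generalized
  over a fresh variable only outside its boxes; the quantifier is then moved in to reach a boxed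
  \<open>Bot\<close>.\<close>

lemma boxn_all: "All x (boxn k A) \<turnstile> boxn k (All x A)"
proof (induction k)
  case (Suc k)
  have "All x (Box (boxn k A)) \<turnstile> Box (All x (boxn k A))"
    by (rule CCpp_Iff(2)[OF CCpp.axiom[OF box_all]])
  with Suc show ?case unfolding boxn_Suc by (meson box_mono ent_trans)
qed auto

section \<open>Equality, also under boxes\<close>

lemma eqrefl_ent: "H \<turnstile> Eq t t"
  by (intro ent_thm CCpp.logic eqrefl)

lemma eq_leibniz:
  assumes "free_for s z A" "free_for t z A"
  shows "Eq s t \<turnstile> Imp (subst A z s) (subst A z t)"
  unfolding ent_def by (intro CCpp.logic eqsubst assms)

lemma eq_sym: "Eq s t \<turnstile> Eq t s"
proof -
  obtain z where "z \<notin> tvars s" using fresh_nat finite_tvars by blast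
  with eq_leibniz[of s z "Eq (Var z) s" t] show ?thesis
    by simp (meson CCpp.logic ent_mp ent_thm eqrefl)
qed

lemma eq_Sc: "Eq s t \<turnstile> Eq (Sc s) (Sc t)"
proof -
  obtain z where "z \<notin> tvars s" using fresh_nat finite_tvars by blast
  with eq_leibniz[of s z "Eq (Sc s) (Sc (Var z))" t] show ?thesis
    by simp (meson CCpp.logic ent_mp ent_thm eqrefl)
qed

lemma atom_eq_left:
  "Eq s s' \<turnstile> Imp (Mem s t) (Mem s' t)" "Eq s s' \<turnstile> Imp (Eq s t) (Eq s' t)"
proof -
  obtain z where "z \<notin> tvars t" using fresh_nat finite_tvars by blast
  with eq_leibniz[of s z "Mem (Var z) t" s'] eq_leibniz[of s z "Eq (Var z) t" s']
  show "Eq s s' \<turnstile> Imp (Mem s t) (Mem s' t)" "Eq s s' \<turnstile> Imp (Eq s t) (Eq s' t)" by simp_all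
qed

lemma atom_eq_right:
  "Eq t t' \<turnstile> Imp (Mem s t) (Mem s t')" "Eq t t' \<turnstile> Imp (Eq s t) (Eq s t')"
proof -
  obtain z where "z \<notin> tvars s" using fresh_nat finite_tvars by blast
  with eq_leibniz[of t z "Mem s (Var z)" t'] eq_leibniz[of t z "Eq s (Var z)" t']
  show "Eq t t' \<turnstile> Imp (Mem s t) (Mem s t')" "Eq t t' \<turnstile> Imp (Eq s t) (Eq s t')" by simp_all
qed

lemma boxn_atom_eq:
  assumes "H \<turnstile> boxn k (Eq s s')" "H \<turnstile> boxn k (Eq t t')"
  shows "H \<turnstile> boxn k (Mem s t) \<Longrightarrow> H \<turnstile> boxn k (Mem s' t')"
    and "H \<turnstile> boxn k (Eq s t) \<Longrightarrow> H \<turnstile> boxn k (Eq s' t')"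
  by (meson assms atom_eq_left atom_eq_right boxn_ent_mp)+

text \<open>Environments replace iterated substitution: \<open>tr\<close> and \<open>forces\<close>
  only update them at quantifiers.\<close>

primrec tinst :: "(nat \<Rightarrow> trm) \<Rightarrow> trm \<Rightarrow> trm" where
  "tinst \<rho> (Var x) = \<rho> x"
| "tinst \<rho> Zero = Zero"
| "tinst \<rho> Omega = Omega"
| "tinst \<rho> (Sc t) = Sc (tinst \<rho> t)"

lemma tinst_Var [simp]: "tinst Var t = t"
  by (induction t) auto

lemma tvars_tinst: "tvars (tinst \<rho> t) = (\<Union>z\<in>tvars t. tvars (\<rho> z))"
  by (induction t) auto

lemma tinst_cong: "(\<And>z. z \<in> tvars t \<Longrightarrow> \<rho> z = \<rho>' z) \<Longrightarrow> tinst \<rho> t = tinst \<rho>' t"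
  by (induction t) auto

lemma tinst_tsubst: "tinst \<rho> (tsubst t x s) = tinst (\<rho>(x := tinst \<rho> s)) t"
  by (induction t) auto

lemma tinst_eq:
  "(\<And>z. z \<in> tvars t \<Longrightarrow> H \<turnstile> boxn k (Eq (\<rho> z) (\<rho>' z))) \<Longrightarrow>
   H \<turnstile> boxn k (Eq (tinst \<rho> t) (tinst \<rho>' t))"
proof (induction t)
  case (Sc t)
  then show ?case by simp (meson boxn_mono ent_trans eq_Sc)
qed (auto intro!: ent_trans[OF _ ent_boxn] eqrefl_ent)

section \<open>Renaming of bound variables\<close>

text \<open>Instantiating a quantifier through the equation \<open>y = t\<close> avoids any lemma on
  iterated capture-avoiding substitution.\<close>

definition extensional :: "nat set \<Rightarrow> (trm \<Rightarrow> fm) \<Rightarrow> bool" where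
  "extensional V F \<longleftrightarrow> finite V \<and> (\<forall>t. fv (F t) \<subseteq> V \<union> tvars t) \<and> (\<forall>s t. Eq s t \<turnstile> Imp (F s) (F t))"

lemma extensional_fresh: "extensional V F \<Longrightarrow> y \<notin> V \<Longrightarrow> y \<notin> tvars t \<Longrightarrow> y \<notin> fv (F t)"
  by (auto simp: extensional_def)

lemma CCpp_ex_eq: "y \<notin> tvars t \<Longrightarrow> CCpp (Ex y (Eq (Var y) t))"
  using CCpp_ent[OF ent_exI[of t y "Eq (Var y) t"]] by (simp add: CCpp.logic eqrefl)

lemma all_inst_aux:
  assumes "extensional V F" "y \<notin> V" "y \<notin> tvars t"
  shows "All y (F (Var y)) \<turnstile> F t"
proof -
  have "Eq (Var y) t \<turnstile> Imp (F (Var y)) (F t)" using assms by (auto simp: extensional_def)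
  moreover have "All y (F (Var y)) \<turnstile> F (Var y)" using ent_allE[of "Var y" y "F (Var y)"] by simp
  ultimately have "Eq (Var y) t \<turnstile> Imp (All y (F (Var y))) (F t)"
    by (meson ent_swap ent_trans)
  moreover have "y \<notin> fv (F t)" using assms by (rule extensional_fresh)
  ultimately have "Ex y (Eq (Var y) t) \<turnstile> Imp (All y (F (Var y))) (F t)"
    by (intro ent_exE) auto
  then show ?thesis using CCpp_ex_eq[OF assms(3)] CCpp_ent ent_def by blast
qed

text \<open>The equation \<open>y = t\<close> can be discharged only if \<open>y\<close> is not in
  \<open>t\<close>; in general the bound variable is first renamed to some \<open>w\<close> fresh
  for \<open>t\<close>.\<close>

lemma all_inst:
  assumes "extensional V F" "y \<notin> V"
  shows "All y (F (Var y)) \<turnstile> F t"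
proof -
  have "finite V" using assms by (auto simp: extensional_def)
  then obtain w where w: "w \<notin> V \<union> tvars t \<union> {y}"
    using fresh_nat[of "V \<union> tvars t \<union> {y}"] by auto
  have "All y (F (Var y)) \<turnstile> F (Var w)" using all_inst_aux[of V F y "Var w"] assms w by auto
  moreover have "w \<notin> fv (All y (F (Var y)))" using extensional_fresh[of V F w "Var y"] assms w by auto
  ultimately have "All y (F (Var y)) \<turnstile> All w (F (Var w))" by (rule ent_allI)
  also have "\<dots> \<turnstile> F t" using all_inst_aux[of V F w t] assms w by auto
  finally show ?thesis .
qed

lemma ex_inst_aux:
  assumes "extensional V F" "y \<notin> V" "y \<notin> tvars t"
  shows "F t \<turnstile> Ex y (F (Var y))"
proof -
  have "Eq t (Var y) \<turnstile> Imp (F t) (F (Var y))" using assms by (auto simp: extensional_def)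
  moreover have "F (Var y) \<turnstile> Ex y (F (Var y))" using ent_exI[of "Var y" y "F (Var y)"] by simp
  ultimately have "Eq (Var y) t \<turnstile> Imp (F t) (Ex y (F (Var y)))"
    by (meson ent_impI ent_impE ent_trans eq_sym)
  moreover have "y \<notin> fv (F t)" using assms by (rule extensional_fresh)
  ultimately have "Ex y (Eq (Var y) t) \<turnstile> Imp (F t) (Ex y (F (Var y)))"
    by (intro ent_exE) auto
  then show ?thesis using CCpp_ex_eq[OF assms(3)] CCpp_ent ent_def by blast
qed

lemma ex_inst:
  assumes "extensional V F" "y \<notin> V"
  shows "F t \<turnstile> Ex y (F (Var y))"
proof -
  have "finite V" using assms by (auto simp: extensional_def)
  then obtain w where w: "w \<notin> V \<union> tvars t \<union> {y}"
    using fresh_nat[of "V \<union> tvars t \<union> {y}"] by auto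
  have "F t \<turnstile> Ex w (F (Var w))" using ex_inst_aux[of V F w t] assms w by auto
  also have "\<dots> \<turnstile> Ex y (F (Var y))"
  proof (rule ent_exE)
    show "F (Var w) \<turnstile> Ex y (F (Var y))" using ex_inst_aux[of V F y "Var w"] assms w by auto
    show "w \<notin> fv (Ex y (F (Var y)))"
      using extensional_fresh[of V F w "Var y"] assms w by auto
  qed
  finally show ?thesis .
qed

text \<open>Eigenvariable rule with renaming: the bound variable \<open>y\<close> of a translation
  is prescribed and may be free in \<open>H\<close>, so the generalization takes place at a fresh
  \<open>w\<close>.\<close>

lemma ent_all_fresh:
  assumes "extensional V F" "y \<notin> V" "w \<notin> V" "w \<notin> fv H" "H \<turnstile> F (Var w)"
  shows "H \<turnstile> All y (F (Var y))"
proof -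
  have "H \<turnstile> All w (F (Var w))" using assms by (intro ent_allI)
  also have "\<dots> \<turnstile> All y (F (Var y))"
  proof (rule ent_allI)
    show "All w (F (Var w)) \<turnstile> F (Var y)" using all_inst assms by blast
    show "y \<notin> fv (All w (F (Var w)))"
      using extensional_fresh[of V F y "Var w"] assms by auto
  qed
  finally show ?thesis .
qed

lemma ent_ex_fresh:
  assumes "extensional V F" "y \<notin> V" "w \<notin> V" "w \<notin> fv H" "w \<notin> fv C" "Conj H (F (Var w)) \<turnstile> C"
  shows "Conj H (Ex y (F (Var y))) \<turnstile> C"
proof -
  have "Ex y (F (Var y)) \<turnstile> Ex w (F (Var w))"
  proof (rule ent_exE)
    show "F (Var y) \<turnstile> Ex w (F (Var w))" using ex_inst assms by blast
    show "y \<notin> fv (Ex w (F (Var w)))"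
      using extensional_fresh[of V F y "Var w"] assms by auto
  qed
  also have "\<dots> \<turnstile> Imp H C" using assms by (intro ent_exE) (auto simp: ent_swap[symmetric] ent_impI)
  finally show ?thesis using ent_impE ent_swap by blast
qed

section \<open>Boxing the positive atoms\<close>

text \<open>The free variables that an instance of the quantified formula can contain, hence those
  that its bound variable has to avoid.\<close>

definition used :: "nat \<Rightarrow> fm \<Rightarrow> (nat \<Rightarrow> trm) \<Rightarrow> nat set" where
  "used x A \<rho> = (\<Union>z\<in>fv A - {x}. tvars (\<rho> z))"

text \<open>Keeping the variable whenever possible makes the instance under \<open>Var\<close> literally equal,
  up to boxes, to the formula itself.\<close>

definition bvar :: "nat \<Rightarrow> fm \<Rightarrow> (nat \<Rightarrow> trm) \<Rightarrow> nat" where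
  "bvar x A \<rho> = (if x \<notin> used x A \<rho> then x else SOME y. y \<notin> used x A \<rho>)"

lemma finite_used [simp]: "finite (used x A \<rho>)"
  by (auto simp: used_def)

lemma bvar_notin: "bvar x A \<rho> \<notin> used x A \<rho>"
  unfolding bvar_def using someI_ex[OF fresh_nat[OF finite_used]] by auto

lemma bvar_Var [simp]: "bvar x A Var = x"
  by (auto simp: bvar_def used_def)

text \<open>For \<open>p = True\<close> the positive atoms of \<open>A\<close> are boxed \<open>k\<close> times, for \<open>p = False\<close> the
  negative ones.\<close>

primrec tr :: "fm \<Rightarrow> bool \<Rightarrow> nat \<Rightarrow> (nat \<Rightarrow> trm) \<Rightarrow> fm" where
  "tr (Mem a b) p k \<rho> = boxn (if p then k else 0) (Mem (tinst \<rho> a) (tinst \<rho> b))"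
| "tr (Eq a b) p k \<rho> = boxn (if p then k else 0) (Eq (tinst \<rho> a) (tinst \<rho> b))"
| "tr (Conj A B) p k \<rho> = Conj (tr A p k \<rho>) (tr B p k \<rho>)"
| "tr (Disj A B) p k \<rho> = Disj (tr A p k \<rho>) (tr B p k \<rho>)"
| "tr (Imp A B) p k \<rho> = Imp (tr A (\<not> p) k \<rho>) (tr B p k \<rho>)"
| "tr (All x A) p k \<rho> = All (bvar x A \<rho>) (tr A p k (\<rho>(x := Var (bvar x A \<rho>))))"
| "tr (Ex x A) p k \<rho> = Ex (bvar x A \<rho>) (tr A p k (\<rho>(x := Var (bvar x A \<rho>))))"
| "tr (Box A) p k \<rho> = tr A p k \<rho>"

lemma erase_tr_Var: "erase (tr A p k Var) = erase A"
  by (induction A arbitrary: p) auto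

lemma fv_tr: "fv (tr A p k \<rho>) \<subseteq> (\<Union>z\<in>fv A. tvars (\<rho> z))"
proof (induction A arbitrary: p \<rho>)
  case (All x A)
  have "fv (tr A p k (\<rho>(x := Var (bvar x A \<rho>)))) \<subseteq> (\<Union>z\<in>fv A. tvars ((\<rho>(x := Var (bvar x A \<rho>))) z))"
    by (rule All.IH)
  then show ?case by (fastforce split: if_splits)
next
  case (Ex x A)
  have "fv (tr A p k (\<rho>(x := Var (bvar x A \<rho>)))) \<subseteq> (\<Union>z\<in>fv A. tvars ((\<rho>(x := Var (bvar x A \<rho>))) z))"
    by (rule Ex.IH)
  then show ?case by (fastforce split: if_splits)
qed (auto simp: tvars_tinst, (blast | fastforce)+)

text \<open>Splits off the variable condition, so that inside the induction for
  \<open>tr_cong\<close> only the induction hypothesis has to be supplied.\<close>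

lemma extensional_trI:
  assumes "\<And>s t. Eq s t \<turnstile> Imp (tr A p k (\<rho>(x := s))) (tr A p k (\<rho>(x := t)))"
  shows "extensional (used x A \<rho>) (\<lambda>t. tr A p k (\<rho>(x := t)))"
proof -
  have "fv (tr A p k (\<rho>(x := t))) \<subseteq> used x A \<rho> \<union> tvars t" for t
    using fv_tr[of A p k "\<rho>(x := t)"] by (fastforce simp: used_def split: if_splits)
  with assms show ?thesis by (auto simp: extensional_def)
qed

text \<open>Monotonicity rests on \<open>A \<turnstile> Box A\<close>: more boxes weaken a positive
  atom. Congruence joins the same induction because the two sides of a quantifier case may have
  different bound variables, and comparing them needs replacement of equals in the matrix.\<close>

lemma tr_cong:
  assumes "\<And>z. z \<in> fv A \<Longrightarrow> H \<turnstile> Eq (\<rho> z) (\<rho>' z)" "if p then k \<le> m else m \<le> k"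
  shows "H \<turnstile> Imp (tr A p k \<rho>) (tr A p m \<rho>')"
  using assms
proof (induction A arbitrary: p k m \<rho> \<rho>' H)
  case (Mem a b)
  define i j where "i = (if p then k else 0)" and "j = (if p then m else 0)"
  let ?H = "Conj H (boxn i (Mem (tinst \<rho> a) (tinst \<rho> b)))"
  have eq: "?H \<turnstile> boxn j (Eq (\<rho> z) (\<rho>' z))" if "z \<in> tvars a \<union> tvars b" for z
    using Mem(1)[of z] that ent_trans[OF ent_conj1 ent_trans[OF _ ent_boxn]] by auto
  have "?H \<turnstile> boxn j (Mem (tinst \<rho> a) (tinst \<rho> b))"
    using Mem(2) by (intro ent_trans[OF ent_conj2 boxn_le]) (auto simp: i_def j_def)
  then have "?H \<turnstile> boxn j (Mem (tinst \<rho>' a) (tinst \<rho>' b))"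
    by (rule boxn_atom_eq(1)[OF tinst_eq tinst_eq, rotated 2]) (use eq in auto)
  then show ?case by (simp add: ent_impI flip: i_def j_def)
next
  case (Eq a b)
  define i j where "i = (if p then k else 0)" and "j = (if p then m else 0)"
  let ?H = "Conj H (boxn i (Eq (tinst \<rho> a) (tinst \<rho> b)))"
  have eq: "?H \<turnstile> boxn j (Eq (\<rho> z) (\<rho>' z))" if "z \<in> tvars a \<union> tvars b" for z
    using Eq(1)[of z] that ent_trans[OF ent_conj1 ent_trans[OF _ ent_boxn]] by auto
  have "?H \<turnstile> boxn j (Eq (tinst \<rho> a) (tinst \<rho> b))"
    using Eq(2) by (intro ent_trans[OF ent_conj2 boxn_le]) (auto simp: i_def j_def)
  then have "?H \<turnstile> boxn j (Eq (tinst \<rho>' a) (tinst \<rho>' b))"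
    by (rule boxn_atom_eq(2)[OF tinst_eq tinst_eq, rotated 2]) (use eq in auto)
  then show ?case by (simp add: ent_impI flip: i_def j_def)
next
  case (Conj A B)
  have "H \<turnstile> Imp (tr A p k \<rho>) (tr A p m \<rho>')" "H \<turnstile> Imp (tr B p k \<rho>) (tr B p m \<rho>')"
    using Conj by auto
  then show ?case by (simp add: ent_conj_cong)
next
  case (Disj A B)
  have "H \<turnstile> Imp (tr A p k \<rho>) (tr A p m \<rho>')" "H \<turnstile> Imp (tr B p k \<rho>) (tr B p m \<rho>')"
    using Disj by auto
  then show ?case by (simp add: ent_disj_cong)
next
  case (Imp A B)
  \<comment> \<open>The antecedent is contravariant: the environments and the numbers of boxes trade
    places, which fits the opposite polarity.\<close>
  have "H \<turnstile> Imp (tr A (\<not> p) m \<rho>') (tr A (\<not> p) k \<rho>)"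
    using Imp.prems by (intro Imp.IH) (auto intro: ent_trans[OF _ eq_sym])
  moreover have "H \<turnstile> Imp (tr B p k \<rho>) (tr B p m \<rho>')" using Imp by auto
  ultimately show ?case by (simp add: ent_imp_cong)
next
  case (All x A)
  \<comment> \<open>The induction hypothesis under the context \<open>Eq s t\<close>, with equal
    numbers of boxes, is the replacement property of the matrix.\<close>
  have ext: "extensional (used x A \<sigma>) (\<lambda>t. tr A p n (\<sigma>(x := t)))" for \<sigma> n
    by (intro extensional_trI All.IH) (auto intro: eqrefl_ent)
  obtain w where w: "w \<notin> used x A \<rho> \<union> used x A \<rho>' \<union> fv H"
    using fresh_nat[of "used x A \<rho> \<union> used x A \<rho>' \<union> fv H"] by auto
  let ?All = "tr (All x A) p k \<rho>"
  have "H \<turnstile> Imp (tr A p k (\<rho>(x := Var w))) (tr A p m (\<rho>'(x := Var w)))"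
    using All.prems by (intro All.IH) (auto intro: eqrefl_ent)
  moreover have "?All \<turnstile> tr A p k (\<rho>(x := Var w))"
    using all_inst[OF ext bvar_notin] by simp
  ultimately have "Conj H ?All \<turnstile> tr A p m (\<rho>'(x := Var w))"
    by (meson ent_conj1 ent_conj2 ent_mp ent_trans)
  moreover have "w \<notin> fv (Conj H ?All)"
    using w fv_tr[of "All x A" p k \<rho>] by (auto simp: used_def)
  ultimately have "Conj H ?All \<turnstile> tr (All x A) p m \<rho>'"
    using w ent_all_fresh[OF ext bvar_notin, of w] by simp
  then show ?case by (rule ent_impI)
next
  case (Ex x A)
  have ext: "extensional (used x A \<sigma>) (\<lambda>t. tr A p n (\<sigma>(x := t)))" for \<sigma> n
    by (intro extensional_trI Ex.IH) (auto intro: eqrefl_ent)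
  obtain w where w: "w \<notin> used x A \<rho> \<union> used x A \<rho>' \<union> fv H"
    using fresh_nat[of "used x A \<rho> \<union> used x A \<rho>' \<union> fv H"] by auto
  let ?Ex = "tr (Ex x A) p m \<rho>'"
  have "H \<turnstile> Imp (tr A p k (\<rho>(x := Var w))) (tr A p m (\<rho>'(x := Var w)))"
    using Ex.prems by (intro Ex.IH) (auto intro: eqrefl_ent)
  moreover have "tr A p m (\<rho>'(x := Var w)) \<turnstile> ?Ex"
    using ex_inst[OF ext bvar_notin] by simp
  ultimately have "Conj H (tr A p k (\<rho>(x := Var w))) \<turnstile> ?Ex"
    by (meson ent_impE ent_trans)
  moreover have "w \<notin> fv ?Ex"
    using w fv_tr[of "Ex x A" p m \<rho>'] by (auto simp: used_def)
  ultimately have "Conj H (tr (Ex x A) p k \<rho>) \<turnstile> ?Ex"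
    using w ent_ex_fresh[OF ext bvar_notin, of w] by simp
  then show ?case by (rule ent_impI)
next
  case (Box A)
  then show ?case by simp
qed

lemma extensional_tr: "extensional (used x A \<rho>) (\<lambda>t. tr A p k (\<rho>(x := t)))"
  by (intro extensional_trI tr_cong) (auto intro: eqrefl_ent)

section \<open>Forcing over sequences of contexts\<close>

definition below :: "(nat \<Rightarrow> fm) \<Rightarrow> (nat \<Rightarrow> fm) \<Rightarrow> bool" (infix "\<preceq>" 40) where
  "\<gamma> \<preceq> c \<longleftrightarrow> (\<forall>\<^sub>F k in sequentially. \<gamma> k \<turnstile> c k)"

text \<open>One finite set for all entries, so that a single eigenvariable serves every
  \<open>k\<close>.\<close>

definition fin :: "(nat \<Rightarrow> fm) \<Rightarrow> bool" where
  "fin c \<longleftrightarrow> finite (\<Union>k. fv (c k))"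

definition world :: "(nat \<Rightarrow> fm) \<Rightarrow> bool" where
  "world \<gamma> \<longleftrightarrow> fin \<gamma> \<and> (\<forall>k. \<gamma> (Suc k) \<turnstile> \<gamma> k)"

definition meet :: "(nat \<Rightarrow> fm) \<Rightarrow> (nat \<Rightarrow> fm) \<Rightarrow> nat \<Rightarrow> fm" where
  "meet \<gamma> \<delta> k = Conj (\<gamma> k) (\<delta> k)"

lemma belowI: "(\<And>k. \<gamma> k \<turnstile> c k) \<Longrightarrow> \<gamma> \<preceq> c"
  by (auto simp: below_def)

lemma below_mono1: "(\<And>k. c k \<turnstile> d k) \<Longrightarrow> \<gamma> \<preceq> c \<Longrightarrow> \<gamma> \<preceq> d"
  unfolding below_def by (auto elim!: eventually_mono intro: ent_trans)

lemma below_mono2: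
  "(\<And>H k. H \<turnstile> c k \<Longrightarrow> H \<turnstile> d k \<Longrightarrow> H \<turnstile> e k) \<Longrightarrow> \<gamma> \<preceq> c \<Longrightarrow> \<gamma> \<preceq> d \<Longrightarrow> \<gamma> \<preceq> e"
  unfolding below_def by (drule (1) eventually_conj, erule eventually_mono) blast

lemma below_refl [simp]: "\<gamma> \<preceq> \<gamma>"
  by (simp add: belowI)

lemma below_trans [trans]: "\<gamma> \<preceq> \<delta> \<Longrightarrow> \<delta> \<preceq> c \<Longrightarrow> \<gamma> \<preceq> c"
  unfolding below_def by (drule (1) eventually_conj, erule eventually_mono) (blast intro: ent_trans)

lemma meet1: "meet \<gamma> \<delta> \<preceq> \<gamma>" and meet2: "meet \<gamma> \<delta> \<preceq> \<delta>"
  by (auto simp: meet_def intro!: belowI ent_conj1 ent_conj2)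

lemma fin_subset: "finite V \<Longrightarrow> (\<And>k. fv (c k) \<subseteq> V) \<Longrightarrow> fin c"
  unfolding fin_def by (rule finite_subset[of _ V]) auto

lemma fin_meet: "fin \<gamma> \<Longrightarrow> fin \<delta> \<Longrightarrow> fin (meet \<gamma> \<delta>)"
  by (rule fin_subset[of "(\<Union>k. fv (\<gamma> k)) \<union> (\<Union>k. fv (\<delta> k))"]) (auto simp: fin_def meet_def)

lemma world_meet: "world \<gamma> \<Longrightarrow> world \<delta> \<Longrightarrow> world (meet \<gamma> \<delta>)"
  by (auto simp: world_def fin_meet) (simp add: meet_def ent_conj_mono)

text \<open>Disjunction and existence are forced in continuation-passing style, relative to all goals
  \<open>c\<close>: with the usual Kripke clauses the reflection \<open>tr_forces\<close> would fail for them.\<close>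

primrec forces :: "fm \<Rightarrow> (nat \<Rightarrow> trm) \<Rightarrow> (nat \<Rightarrow> fm) \<Rightarrow> bool" where
  "forces (Mem a b) \<rho> \<gamma> \<longleftrightarrow> \<gamma> \<preceq> (\<lambda>k. boxn k (Mem (tinst \<rho> a) (tinst \<rho> b)))"
| "forces (Eq a b) \<rho> \<gamma> \<longleftrightarrow> \<gamma> \<preceq> (\<lambda>k. boxn k (Eq (tinst \<rho> a) (tinst \<rho> b)))"
| "forces (Conj A B) \<rho> \<gamma> \<longleftrightarrow> forces A \<rho> \<gamma> \<and> forces B \<rho> \<gamma>"
| "forces (Disj A B) \<rho> \<gamma> \<longleftrightarrow> (\<forall>\<delta> c. world \<delta> \<longrightarrow> \<delta> \<preceq> \<gamma> \<longrightarrow> fin c \<longrightarrow>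
     (\<forall>\<epsilon>. world \<epsilon> \<longrightarrow> \<epsilon> \<preceq> \<delta> \<longrightarrow> forces A \<rho> \<epsilon> \<longrightarrow> \<epsilon> \<preceq> c) \<longrightarrow>
     (\<forall>\<epsilon>. world \<epsilon> \<longrightarrow> \<epsilon> \<preceq> \<delta> \<longrightarrow> forces B \<rho> \<epsilon> \<longrightarrow> \<epsilon> \<preceq> c) \<longrightarrow> \<delta> \<preceq> c)"
| "forces (Imp A B) \<rho> \<gamma> \<longleftrightarrow> (\<forall>\<delta>. world \<delta> \<longrightarrow> \<delta> \<preceq> \<gamma> \<longrightarrow> forces A \<rho> \<delta> \<longrightarrow> forces B \<rho> \<delta>)"
| "forces (All x A) \<rho> \<gamma> \<longleftrightarrow> (\<forall>t. forces A (\<rho>(x := t)) \<gamma>)"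
| "forces (Ex x A) \<rho> \<gamma> \<longleftrightarrow> (\<forall>\<delta> c. world \<delta> \<longrightarrow> \<delta> \<preceq> \<gamma> \<longrightarrow> fin c \<longrightarrow>
     (\<forall>t \<epsilon>. world \<epsilon> \<longrightarrow> \<epsilon> \<preceq> \<delta> \<longrightarrow> forces A (\<rho>(x := t)) \<epsilon> \<longrightarrow> \<epsilon> \<preceq> c) \<longrightarrow> \<delta> \<preceq> c)"
| "forces (Box A) \<rho> \<gamma> \<longleftrightarrow> forces A \<rho> \<gamma>"

declare forces.simps(4) [simp del] forces.simps(7) [simp del]

lemma forces_DisjI:
  assumes "\<And>\<delta> c. world \<delta> \<Longrightarrow> \<delta> \<preceq> \<gamma> \<Longrightarrow> fin c \<Longrightarrow>
      (\<And>\<epsilon>. world \<epsilon> \<Longrightarrow> \<epsilon> \<preceq> \<delta> \<Longrightarrow> forces A \<rho> \<epsilon> \<Longrightarrow> \<epsilon> \<preceq> c) \<Longrightarrow>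
      (\<And>\<epsilon>. world \<epsilon> \<Longrightarrow> \<epsilon> \<preceq> \<delta> \<Longrightarrow> forces B \<rho> \<epsilon> \<Longrightarrow> \<epsilon> \<preceq> c) \<Longrightarrow> \<delta> \<preceq> c"
  shows "forces (Disj A B) \<rho> \<gamma>"
  unfolding forces.simps by (intro allI impI, rule assms) blast+

lemma forces_DisjE:
  assumes "forces (Disj A B) \<rho> \<gamma>" "world \<delta>" "\<delta> \<preceq> \<gamma>" "fin c"
    and "\<And>\<epsilon>. world \<epsilon> \<Longrightarrow> \<epsilon> \<preceq> \<delta> \<Longrightarrow> forces A \<rho> \<epsilon> \<Longrightarrow> \<epsilon> \<preceq> c"
    and "\<And>\<epsilon>. world \<epsilon> \<Longrightarrow> \<epsilon> \<preceq> \<delta> \<Longrightarrow> forces B \<rho> \<epsilon> \<Longrightarrow> \<epsilon> \<preceq> c"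
  shows "\<delta> \<preceq> c"
  by (rule assms(1)[unfolded forces.simps, rule_format]) (use assms(2-) in blast)+

lemma forces_ExI:
  assumes "\<And>\<delta> c. world \<delta> \<Longrightarrow> \<delta> \<preceq> \<gamma> \<Longrightarrow> fin c \<Longrightarrow>
      (\<And>t \<epsilon>. world \<epsilon> \<Longrightarrow> \<epsilon> \<preceq> \<delta> \<Longrightarrow> forces A (\<rho>(x := t)) \<epsilon> \<Longrightarrow> \<epsilon> \<preceq> c) \<Longrightarrow> \<delta> \<preceq> c"
  shows "forces (Ex x A) \<rho> \<gamma>"
  unfolding forces.simps by (intro allI impI, rule assms) blast+

lemma forces_ExE:
  assumes "forces (Ex x A) \<rho> \<gamma>" "world \<delta>" "\<delta> \<preceq> \<gamma>" "fin c"
    and "\<And>t \<epsilon>. world \<epsilon> \<Longrightarrow> \<epsilon> \<preceq> \<delta> \<Longrightarrow> forces A (\<rho>(x := t)) \<epsilon> \<Longrightarrow> \<epsilon> \<preceq> c"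
  shows "\<delta> \<preceq> c"
  by (rule assms(1)[unfolded forces.simps, rule_format]) (use assms(2-) in blast)+

lemma forces_mono: "forces A \<rho> \<gamma> \<Longrightarrow> \<delta> \<preceq> \<gamma> \<Longrightarrow> forces A \<rho> \<delta>"
proof (induction A arbitrary: \<rho>)
  case (Mem a b)
  then show ?case using below_trans by simp
next
  case (Eq a b)
  then show ?case using below_trans by simp
next
  case (Disj A B)
  show ?case by (rule forces_DisjI, rule forces_DisjE[OF Disj.prems(1)])
    (auto intro: below_trans[OF _ Disj.prems(2)])
next
  case (Imp A B)
  then show ?case using below_trans[OF _ Imp.prems(2)] by simp
next
  case (Ex x A)
  show ?case by (rule forces_ExI, rule forces_ExE[OF Ex.prems(1)])
    (auto intro: below_trans[OF _ Ex.prems(2)])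
qed simp_all

lemma forces_cong: "(\<And>z. z \<in> fv A \<Longrightarrow> \<rho> z = \<rho>' z) \<Longrightarrow> forces A \<rho> \<gamma> \<longleftrightarrow> forces A \<rho>' \<gamma>"
proof (induction A arbitrary: \<rho> \<rho>' \<gamma>)
  case (Mem a b)
  then have "tinst \<rho> a = tinst \<rho>' a" "tinst \<rho> b = tinst \<rho>' b" by (auto intro: tinst_cong)
  then show ?case by simp
next
  case (Eq a b)
  then have "tinst \<rho> a = tinst \<rho>' a" "tinst \<rho> b = tinst \<rho>' b" by (auto intro: tinst_cong)
  then show ?case by simp
next
  case (Conj A B)
  have "forces A \<rho> \<gamma> = forces A \<rho>' \<gamma>" "forces B \<rho> \<gamma> = forces B \<rho>' \<gamma>"
    by (rule Conj.IH; use Conj.prems in simp)+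
  then show ?case by simp
next
  case (Disj A B)
  have "forces A \<rho> = forces A \<rho>'" "forces B \<rho> = forces B \<rho>'"
    unfolding fun_eq_iff by (rule allI, rule Disj.IH; use Disj.prems in simp)+
  then show ?case by (simp add: forces.simps(4))
next
  case (Imp A B)
  have "forces A \<rho> = forces A \<rho>'" "forces B \<rho> = forces B \<rho>'"
    unfolding fun_eq_iff by (rule allI, rule Imp.IH; use Imp.prems in simp)+
  then show ?case by simp
next
  case (All x A)
  have "forces A (\<rho>(x := t)) = forces A (\<rho>'(x := t))" for t
    unfolding fun_eq_iff using All.prems by (intro allI All.IH) auto
  then show ?case by simp
next
  case (Ex x A)
  have "forces A (\<rho>(x := t)) = forces A (\<rho>'(x := t))" for t
    unfolding fun_eq_iff using Ex.prems by (intro allI Ex.IH) auto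
  then show ?case by (simp add: forces.simps(7))
next
  case (Box A)
  have "forces A \<rho> \<gamma> = forces A \<rho>' \<gamma>" by (rule Box.IH) (use Box.prems in simp)
  then show ?case by simp
qed

lemma forces_subst:
  "free_for t x A \<Longrightarrow> forces (subst A x t) \<rho> \<gamma> \<longleftrightarrow> forces A (\<rho>(x := tinst \<rho> t)) \<gamma>"
proof (induction A arbitrary: \<rho> \<gamma>)
  case (All y A)
  show ?case
  \<comment> \<open>\<open>free_for\<close> admits a vacuous substitution under any binder; the
    formula is then unchanged and only the environments have to be compared.\<close>
  proof (cases "y = x \<or> x \<notin> fv A")
    case True
    have "subst B x t = B" if "x \<notin> fv B" for B using that by (induction B) auto
    with True have "subst (All y A) x t = All y A" by auto
    moreover have "forces (All y A) \<rho> \<gamma> = forces (All y A) (\<rho>(x := tinst \<rho> t)) \<gamma>"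
      using True by (intro forces_cong) auto
    ultimately show ?thesis by (simp only:)
  next
    case False
    then have "tinst (\<rho>(y := s)) t = tinst \<rho> t" for s
      using All.prems by (intro tinst_cong) auto
    with False All show ?thesis by (simp add: fun_upd_twist del: fun_upd_apply)
  qed
next
  case (Ex y A)
  show ?case
  proof (cases "y = x \<or> x \<notin> fv A")
    case True
    have "subst B x t = B" if "x \<notin> fv B" for B using that by (induction B) auto
    with True have "subst (Ex y A) x t = Ex y A" by auto
    moreover have "forces (Ex y A) \<rho> \<gamma> = forces (Ex y A) (\<rho>(x := tinst \<rho> t)) \<gamma>"
      using True by (intro forces_cong) auto
    ultimately show ?thesis by (simp only:)
  next
    case False
    then have "tinst (\<rho>(y := s)) t = tinst \<rho> t" for s
      using Ex.prems by (intro tinst_cong) auto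
    with False Ex show ?thesis by (simp add: forces.simps(7) fun_upd_twist del: fun_upd_apply)
  qed
qed (simp_all add: tinst_tsubst forces.simps(4))

text \<open>The clauses for disjunction and existence eliminate only into goals \<open>c\<close>;
  this extends them to elimination into any formula. It holds because a boxed atom is itself a goal,
  and the property passes through every connective.\<close>

lemma forces_run:
  assumes "world \<gamma>"
    and "\<And>\<delta> c. world \<delta> \<Longrightarrow> \<delta> \<preceq> \<gamma> \<Longrightarrow> fin c \<Longrightarrow>
      (\<And>\<epsilon>. world \<epsilon> \<Longrightarrow> \<epsilon> \<preceq> \<delta> \<Longrightarrow> forces A \<rho> \<epsilon> \<Longrightarrow> \<epsilon> \<preceq> c) \<Longrightarrow> \<delta> \<preceq> c"
  shows "forces A \<rho> \<gamma>"
  using assms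
proof (induction A arbitrary: \<rho> \<gamma>)
  case (Mem a b)
  have "fin (\<lambda>k. boxn k (Mem (tinst \<rho> a) (tinst \<rho> b)))"
    by (rule fin_subset[of "fv (Mem (tinst \<rho> a) (tinst \<rho> b))"]) simp_all
  then show ?case using Mem.prems(2)[of \<gamma>] Mem.prems(1) by simp
next
  case (Eq a b)
  have "fin (\<lambda>k. boxn k (Eq (tinst \<rho> a) (tinst \<rho> b)))"
    by (rule fin_subset[of "fv (Eq (tinst \<rho> a) (tinst \<rho> b))"]) simp_all
  then show ?case using Eq.prems(2)[of \<gamma>] Eq.prems(1) by simp
next
  case (Conj A B)
  have "forces A \<rho> \<gamma>" by (rule Conj.IH, fact, rule Conj.prems(2)) auto
  moreover have "forces B \<rho> \<gamma>" by (rule Conj.IH, fact, rule Conj.prems(2)) auto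
  ultimately show ?case by simp
next
  case (Disj A B)
  show ?case
  proof (rule forces_DisjI)
    fix \<delta> c
    assume *: "world \<delta>" "\<delta> \<preceq> \<gamma>" "fin c"
      "\<And>\<epsilon>. world \<epsilon> \<Longrightarrow> \<epsilon> \<preceq> \<delta> \<Longrightarrow> forces A \<rho> \<epsilon> \<Longrightarrow> \<epsilon> \<preceq> c"
      "\<And>\<epsilon>. world \<epsilon> \<Longrightarrow> \<epsilon> \<preceq> \<delta> \<Longrightarrow> forces B \<rho> \<epsilon> \<Longrightarrow> \<epsilon> \<preceq> c"
    show "\<delta> \<preceq> c"
    proof (rule Disj.prems(2)[OF *(1-3)])
      fix \<epsilon> assume \<epsilon>: "world \<epsilon>" "\<epsilon> \<preceq> \<delta>" "forces (Disj A B) \<rho> \<epsilon>"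
      show "\<epsilon> \<preceq> c"
        by (rule forces_DisjE[OF \<epsilon>(3,1) below_refl *(3)])
           (auto intro: *(4,5) below_trans[OF _ \<epsilon>(2)])
    qed
  qed
next
  case (Imp A B)
  have "forces B \<rho> \<delta>" if \<delta>: "world \<delta>" "\<delta> \<preceq> \<gamma>" "forces A \<rho> \<delta>" for \<delta>
  proof (rule Imp.IH(2)[OF \<delta>(1)])
    fix \<delta>' c
    assume *: "world \<delta>'" "\<delta>' \<preceq> \<delta>" "fin c"
      "\<And>\<epsilon>. world \<epsilon> \<Longrightarrow> \<epsilon> \<preceq> \<delta>' \<Longrightarrow> forces B \<rho> \<epsilon> \<Longrightarrow> \<epsilon> \<preceq> c"
    show "\<delta>' \<preceq> c"
    proof (rule Imp.prems(2)[OF *(1) below_trans[OF *(2) \<delta>(2)] *(3)])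
      fix \<epsilon> assume \<epsilon>: "world \<epsilon>" "\<epsilon> \<preceq> \<delta>'" "forces (Imp A B) \<rho> \<epsilon>"
      have "forces A \<rho> \<epsilon>" using forces_mono[OF \<delta>(3)] below_trans[OF \<epsilon>(2) *(2)] .
      with \<epsilon> * show "\<epsilon> \<preceq> c" by simp
    qed
  qed
  then show ?case by simp
next
  case (All x A)
  have "forces A (\<rho>(x := t)) \<gamma>" for t
    by (rule All.IH, fact, rule All.prems(2)) (auto simp del: fun_upd_apply)
  then show ?case by simp
next
  case (Ex x A)
  show ?case
  proof (rule forces_ExI)
    fix \<delta> c
    assume *: "world \<delta>" "\<delta> \<preceq> \<gamma>" "fin c"
      "\<And>t \<epsilon>. world \<epsilon> \<Longrightarrow> \<epsilon> \<preceq> \<delta> \<Longrightarrow> forces A (\<rho>(x := t)) \<epsilon> \<Longrightarrow> \<epsilon> \<preceq> c"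
    show "\<delta> \<preceq> c"
    proof (rule Ex.prems(2)[OF *(1-3)])
      fix \<epsilon> assume \<epsilon>: "world \<epsilon>" "\<epsilon> \<preceq> \<delta>" "forces (Ex x A) \<rho> \<epsilon>"
      show "\<epsilon> \<preceq> c"
        by (rule forces_ExE[OF \<epsilon>(3,1) below_refl *(3)])
           (rule *(4)[OF _ below_trans[OF _ \<epsilon>(2)]])
    qed
  qed
next
  case (Box A)
  have "forces A \<rho> \<gamma>" by (rule Box.IH, fact, rule Box.prems(2)) auto
  then show ?case by simp
qed

section \<open>Soundness of the logic\<close>

lemma below_tinst_eq:
  "(\<And>z. z \<in> tvars t \<Longrightarrow> \<gamma> \<preceq> (\<lambda>k. boxn k (Eq (\<rho> z) (\<rho>' z)))) \<Longrightarrow>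
   \<gamma> \<preceq> (\<lambda>k. boxn k (Eq (tinst \<rho> t) (tinst \<rho>' t)))"
proof (induction t)
  case (Sc t)
  then have "\<gamma> \<preceq> (\<lambda>k. boxn k (Eq (tinst \<rho> t) (tinst \<rho>' t)))" by simp
  then show ?case by simp (rule below_mono1[OF boxn_mono[OF eq_Sc]])
qed (auto intro: belowI ent_trans[OF eqrefl_ent ent_boxn])

lemma below_eq_refl: "\<gamma> \<preceq> (\<lambda>k. boxn k (Eq t t))"
  by (intro belowI ent_trans[OF eqrefl_ent ent_boxn])

lemma below_eq_sym: "\<gamma> \<preceq> (\<lambda>k. boxn k (Eq s t)) \<Longrightarrow> \<gamma> \<preceq> (\<lambda>k. boxn k (Eq t s))"
  by (rule below_mono1[OF boxn_mono[OF eq_sym]])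

text \<open>A forced equation is known only under \<open>k\<close> boxes, but so is a forced atom,
  and replacement works under boxes by \<open>boxn_atom_eq\<close>.\<close>

lemma forces_eq:
  "forces A \<rho> \<gamma> \<Longrightarrow> (\<And>z. z \<in> fv A \<Longrightarrow> \<gamma> \<preceq> (\<lambda>k. boxn k (Eq (\<rho> z) (\<rho>' z)))) \<Longrightarrow> forces A \<rho>' \<gamma>"
proof (induction A arbitrary: \<rho> \<rho>' \<gamma>)
  case (Mem a b)
  have a: "\<gamma> \<preceq> (\<lambda>k. boxn k (Eq (tinst \<rho> a) (tinst \<rho>' a)))"
    and b: "\<gamma> \<preceq> (\<lambda>k. boxn k (Eq (tinst \<rho> b) (tinst \<rho>' b)))"
    using Mem.prems by (auto intro: below_tinst_eq)
  have "\<gamma> \<preceq> (\<lambda>k. boxn k (Mem (tinst \<rho> a) (tinst \<rho> b)))" using Mem.prems by simp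
  with a b show ?case unfolding below_def forces.simps
    by eventually_elim (rule boxn_atom_eq)
next
  case (Eq a b)
  have a: "\<gamma> \<preceq> (\<lambda>k. boxn k (Eq (tinst \<rho> a) (tinst \<rho>' a)))"
    and b: "\<gamma> \<preceq> (\<lambda>k. boxn k (Eq (tinst \<rho> b) (tinst \<rho>' b)))"
    using Eq.prems by (auto intro: below_tinst_eq)
  have "\<gamma> \<preceq> (\<lambda>k. boxn k (Eq (tinst \<rho> a) (tinst \<rho> b)))" using Eq.prems by simp
  with a b show ?case unfolding below_def forces.simps
    by eventually_elim (rule boxn_atom_eq)
next
  case (Conj A B)
  have "forces A \<rho>' \<gamma>" by (rule Conj.IH(1)[of \<rho>]) (use Conj.prems in auto)
  moreover have "forces B \<rho>' \<gamma>" by (rule Conj.IH(2)[of \<rho>]) (use Conj.prems in auto)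
  ultimately show ?case by simp
next
  case (Disj A B)
  have A: "forces A \<rho>' \<epsilon>" if "forces A \<rho> \<epsilon>" "\<epsilon> \<preceq> \<gamma>" for \<epsilon>
    by (rule Disj.IH(1)[of \<rho>]) (use Disj.prems(2) that in \<open>auto intro: below_trans\<close>)
  have B: "forces B \<rho>' \<epsilon>" if "forces B \<rho> \<epsilon>" "\<epsilon> \<preceq> \<gamma>" for \<epsilon>
    by (rule Disj.IH(2)[of \<rho>]) (use Disj.prems(2) that in \<open>auto intro: below_trans\<close>)
  show ?case by (rule forces_DisjI, rule forces_DisjE[OF Disj.prems(1)])
    (blast intro: A B below_trans)+
next
  case (Imp A B)
  have A: "forces A \<rho> \<epsilon>" if "forces A \<rho>' \<epsilon>" "\<epsilon> \<preceq> \<gamma>" for \<epsilon>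
    by (rule Imp.IH(1)[of \<rho>']) (use Imp.prems(2) that in \<open>auto intro: below_trans below_eq_sym\<close>)
  have B: "forces B \<rho>' \<epsilon>" if "forces B \<rho> \<epsilon>" "\<epsilon> \<preceq> \<gamma>" for \<epsilon>
    by (rule Imp.IH(2)[of \<rho>]) (use Imp.prems(2) that in \<open>auto intro: below_trans\<close>)
  from Imp.prems(1) A B show ?case by simp
next
  case (All x A)
  have "forces A (\<rho>'(x := t)) \<gamma>" for t
  proof (rule All.IH)
    show "forces A (\<rho>(x := t)) \<gamma>" using All.prems(1) by simp
  qed (use All.prems(2) in \<open>auto intro!: below_eq_refl\<close>)
  then show ?case by simp
next
  case (Ex x A)
  have A: "forces A (\<rho>'(x := t)) \<epsilon>" if "forces A (\<rho>(x := t)) \<epsilon>" "\<epsilon> \<preceq> \<gamma>" for \<epsilon> t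
    by (rule Ex.IH[OF that(1)]) (use Ex.prems(2) that(2) in \<open>auto intro: below_trans below_eq_refl\<close>)
  show ?case by (rule forces_ExI, rule forces_ExE[OF Ex.prems(1)])
    (blast intro: A below_trans)+
next
  case (Box A)
  have "forces A \<rho>' \<gamma>" by (rule Box.IH[of \<rho>]) (use Box.prems in auto)
  then show ?case by simp
qed

lemma forces_disj1: "forces A \<rho> \<gamma> \<Longrightarrow> forces (Disj A B) \<rho> \<gamma>"
  and forces_disj2: "forces B \<rho> \<gamma> \<Longrightarrow> forces (Disj A B) \<rho> \<gamma>"
  by (auto intro!: forces_DisjI dest: forces_mono)

lemma forces_ex: "forces A (\<rho>(x := t)) \<gamma> \<Longrightarrow> forces (Ex x A) \<rho> \<gamma>"
  by (auto intro!: forces_ExI dest: forces_mono)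

text \<open>The generic instance \<open>v0 \<in> v1\<close> of \<open>Bot\<close> at fresh variables yields \<open>Bot\<close> itself.\<close>

lemma forces_Bot_imp_below:
  assumes "world \<gamma>" "forces Bot \<rho> \<gamma>"
  shows "\<gamma> \<preceq> (\<lambda>k. boxn k Bot)"
proof -
  have fin: "finite (\<Union>k. fv (\<gamma> k))" using assms by (auto simp: world_def fin_def)
  \<comment> \<open>\<open>u\<close> and \<open>v\<close> avoid all entries at once, since they are
    generalized at every \<open>k\<close> beyond one threshold.\<close>
  obtain u where u: "u \<notin> (\<Union>k. fv (\<gamma> k)) \<union> {0, 1}"
    using fresh_nat[of "(\<Union>k. fv (\<gamma> k)) \<union> {0, 1}"] fin by auto
  obtain v where v: "v \<notin> (\<Union>k. fv (\<gamma> k)) \<union> {0, 1, u}"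
    using fresh_nat[of "(\<Union>k. fv (\<gamma> k)) \<union> {0, 1, u}"] fin by auto
  let ?B = "All u (All v (Mem (Var u) (Var v)))"
  have "?B \<turnstile> All v (Mem (Var 0) (Var v))"
    using ent_allE[of "Var 0" u "All v (Mem (Var u) (Var v))"] u v by simp
  also have "\<dots> \<turnstile> Mem (Var 0) (Var 1)"
    using ent_allE[of "Var 1" v "Mem (Var 0) (Var v)"] v by simp
  finally have B: "?B \<turnstile> Bot" unfolding Bot_def by (intro ent_allI) (use u v in auto)
  have "\<gamma> \<preceq> (\<lambda>k. boxn k (Mem (Var u) (Var v)))"
    using assms(2) by (auto simp: Bot_def dest: spec[of _ "Var u"] spec[of _ "Var v"])
  then show ?thesis unfolding below_def
  proof eventually_elim
    case (elim k)
    then have "\<gamma> k \<turnstile> All v (boxn k (Mem (Var u) (Var v)))" using v by (intro ent_allI) auto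
    also note boxn_all
    finally have "\<gamma> k \<turnstile> All u (boxn k (All v (Mem (Var u) (Var v))))"
      using u by (intro ent_allI) auto
    also note boxn_all
    also note boxn_mono[OF B]
    finally show ?case .
  qed
qed

lemma below_efq: "\<gamma> \<preceq> (\<lambda>k. boxn k Bot) \<Longrightarrow> \<gamma> \<preceq> (\<lambda>k. boxn k A)"
  by (erule below_mono1[rotated], rule boxn_mono) (simp add: ent_def CCpp.logic efq)

text \<open>Boxed falsity entails every atom under the same boxes, and this spreads to all formulas.
  The boxed form is what \<open>Sx = 0\<close> yields.\<close>

lemma forces_efq: "\<gamma> \<preceq> (\<lambda>k. boxn k Bot) \<Longrightarrow> forces A \<rho> \<gamma>"
proof (induction A arbitrary: \<rho> \<gamma>)
  case (Disj A B)
  then show ?case using forces_disj1 by blast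
next
  case (Imp A B)
  then show ?case using below_trans by simp
next
  case (Ex x A)
  then have "forces A (\<rho>(x := Zero)) \<gamma>" by simp
  then show ?case by (rule forces_ex)
qed (simp_all add: below_efq)

lemma forces_logax:
  assumes "logax A" "world \<gamma>"
  shows "forces A \<rho> \<gamma>"
  using assms
proof (induction rule: logax.induct)
  case (ax1 A B)
  then show ?case by (auto dest: forces_mono)
next
  case (ax2 A B C)
  then show ?case by simp (meson below_refl below_trans forces_mono)
next
  case (ax3 A B)
  then show ?case by simp
next
  case (ax4 A B)
  then show ?case by simp
next
  case (ax5 A B)
  then show ?case by (auto dest: forces_mono)
next
  case (ax6 A B)
  then show ?case using forces_disj1 by simp
next
  case (ax7 B A)
  then show ?case using forces_disj2 by simp
next
  case (ax8 A C B)
  \<comment> \<open>\<open>C\<close> need not be a goal, so the case distinction is made inside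
    \<open>forces_run\<close>.\<close>
  have "forces C \<rho> \<epsilon>"
    if AC: "forces (Imp A C) \<rho> \<delta>" and \<delta>': "\<delta>' \<preceq> \<delta>" and BC: "forces (Imp B C) \<rho> \<delta>'"
      and \<epsilon>: "world \<epsilon>" "\<epsilon> \<preceq> \<delta>'" and AB: "forces (Disj A B) \<rho> \<epsilon>" for \<delta> \<delta>' \<epsilon>
  proof (rule forces_run[OF \<epsilon>(1)])
    fix \<zeta> c
    assume *: "world \<zeta>" "\<zeta> \<preceq> \<epsilon>" "fin c"
      "\<And>\<eta>. world \<eta> \<Longrightarrow> \<eta> \<preceq> \<zeta> \<Longrightarrow> forces C \<rho> \<eta> \<Longrightarrow> \<eta> \<preceq> c"
    have "\<eta> \<preceq> c" if "world \<eta>" "\<eta> \<preceq> \<zeta>" "forces A \<rho> \<eta> \<or> forces B \<rho> \<eta>" for \<eta>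
    proof -
      have "\<eta> \<preceq> \<delta>'" using that * \<epsilon> by (meson below_trans)
      with that AC BC \<delta>' have "forces C \<rho> \<eta>" by simp (meson below_trans)
      with that * show ?thesis by blast
    qed
    then show "\<zeta> \<preceq> c" by (intro forces_DisjE[OF AB *(1-3)]) blast+
  qed
  then show ?case by simp
next
  case (efq A)
  then show ?case by (auto intro: forces_efq forces_Bot_imp_below)
next
  case (allE t x A)
  then show ?case by (simp add: forces_subst)
next
  case (exI t x A)
  then show ?case using forces_ex by (simp add: forces_subst)
next
  case (eqrefl t)
  then show ?case by (simp add: below_eq_refl)
next
  case (eqsubst s z A t)
  have "forces A (\<rho>(z := tinst \<rho> t)) \<epsilon>"
    if "\<delta> \<preceq> (\<lambda>k. boxn k (Eq (tinst \<rho> s) (tinst \<rho> t)))" "\<epsilon> \<preceq> \<delta>"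
      "forces A (\<rho>(z := tinst \<rho> s)) \<epsilon>" for \<delta> \<epsilon>
    by (rule forces_eq[OF that(3)])
       (use that in \<open>auto intro: below_trans below_eq_refl\<close>)
  with eqsubst show ?case by (simp add: forces_subst)
qed

section \<open>Forcing and provability of the boxed formulas\<close>

lemma fin_tr: "fin (\<lambda>k. tr A p k \<rho>)"
  by (rule fin_subset[OF _ fv_tr]) auto

text \<open>With \<open>p = False\<close> the boxes sit on negative atoms, where more of them make
  the formula stronger.\<close>

lemma world_tr: "world (\<lambda>k. tr A False k \<rho>)"
  unfolding world_def
proof (intro conjI allI fin_tr)
  fix k
  have "Eq Zero Zero \<turnstile> Imp (tr A False (Suc k) \<rho>) (tr A False k \<rho>)"
    by (rule tr_cong) (simp_all add: eqrefl_ent)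
  then show "tr A False (Suc k) \<rho> \<turnstile> tr A False k \<rho>"
    unfolding ent_def[of "tr A False (Suc k) \<rho>"] by (rule CCpp_ent) (intro CCpp.logic eqrefl)
qed

text \<open>The two parts play the roles of the identity and of the right rules of a cut-free calculus;
  they need each other at implications.\<close>

lemma
  shows tr_forces: "forces A \<rho> (\<lambda>k. tr A False k \<rho>)"
    and forces_imp_tr: "world \<gamma> \<Longrightarrow> forces A \<rho> \<gamma> \<Longrightarrow> \<gamma> \<preceq> (\<lambda>k. tr A True k \<rho>)"
proof (induction A arbitrary: \<rho> \<gamma>)
  case (Mem a b)
  \<comment> \<open>Identity axiom: the context contains the bare atom, while forcing asks for
    \<open>k\<close> boxes.\<close>
  { case 1 show ?case by (simp add: belowI ent_boxn) }
  { case 2 then show ?case by simp }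
next
  case (Eq a b)
  { case 1 show ?case by (simp add: belowI ent_boxn) }
  { case 2 then show ?case by simp }
next
  case (Conj A B)
  { case 1 show ?case
      using forces_mono[OF Conj.IH(1)] forces_mono[OF Conj.IH(3)]
      by (simp add: belowI ent_conj1 ent_conj2) }
  { case 2
    then have "\<gamma> \<preceq> (\<lambda>k. tr A True k \<rho>)" "\<gamma> \<preceq> (\<lambda>k. tr B True k \<rho>)" using Conj.IH by auto
    then show ?case unfolding tr.simps by (rule below_mono2[rotated]) (rule ent_conjI) }
next
  case (Disj A B)
  { case 1 show ?case
    proof (rule forces_DisjI)
      fix \<delta> c
      assume \<delta>: "world \<delta>" "\<delta> \<preceq> (\<lambda>k. tr (Disj A B) False k \<rho>)" "fin c"
        and A: "\<And>\<epsilon>. world \<epsilon> \<Longrightarrow> \<epsilon> \<preceq> \<delta> \<Longrightarrow> forces A \<rho> \<epsilon> \<Longrightarrow> \<epsilon> \<preceq> c"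
        and B: "\<And>\<epsilon>. world \<epsilon> \<Longrightarrow> \<epsilon> \<preceq> \<delta> \<Longrightarrow> forces B \<rho> \<epsilon> \<Longrightarrow> \<epsilon> \<preceq> c"
      \<comment> \<open>Left rule: the continuation is applied at the world extended by the
        translated disjunct, which is forced there by induction.\<close>
      have "meet \<delta> (\<lambda>k. tr A False k \<rho>) \<preceq> c"
        by (intro A world_meet \<delta> world_tr meet1 forces_mono[OF Disj.IH(1) meet2])
      moreover have "meet \<delta> (\<lambda>k. tr B False k \<rho>) \<preceq> c"
        by (intro B world_meet \<delta> world_tr meet1 forces_mono[OF Disj.IH(3) meet2])
      ultimately show "\<delta> \<preceq> c" using \<delta>(2) unfolding below_def meet_def tr.simps
        by eventually_elim (meson ent_conjI ent_disjE ent_refl ent_trans)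
    qed }
  { case 2 show ?case
    \<comment> \<open>The goal chosen for \<open>c\<close> is the translation of the disjunction
      itself.\<close>
    proof (rule forces_DisjE[OF 2(2,1) below_refl fin_tr])
      show "\<epsilon> \<preceq> (\<lambda>k. tr (Disj A B) True k \<rho>)" if "world \<epsilon>" "forces A \<rho> \<epsilon>" for \<epsilon>
        using Disj.IH(2)[OF that] unfolding tr.simps by (rule below_mono1[rotated]) (rule ent_disj1)
      show "\<epsilon> \<preceq> (\<lambda>k. tr (Disj A B) True k \<rho>)" if "world \<epsilon>" "forces B \<rho> \<epsilon>" for \<epsilon>
        using Disj.IH(4)[OF that] unfolding tr.simps by (rule below_mono1[rotated]) (rule ent_disj2)
    qed }
next
  case (Imp A B)
  { case 1
    have "forces B \<rho> \<delta>"
      if "world \<delta>" "\<delta> \<preceq> (\<lambda>k. tr (Imp A B) False k \<rho>)" "forces A \<rho> \<delta>" for \<delta>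
    proof (rule forces_mono[OF Imp.IH(3)])
      have "\<delta> \<preceq> (\<lambda>k. tr A True k \<rho>)" using Imp.IH(2) that by blast
      with that(2) show "\<delta> \<preceq> (\<lambda>k. tr B False k \<rho>)"
        by (rule below_mono2[rotated]) (simp add: ent_mp)
    qed
    then show ?case by simp }
  { case 2
    \<comment> \<open>Right rule: the translated antecedent is added to every entry of the world and
      discharged afterwards.\<close>
    let ?A = "\<lambda>k. tr A False k \<rho>"
    have m: "world (meet \<gamma> ?A)" using 2 world_tr by (intro world_meet)
    have "forces A \<rho> (meet \<gamma> ?A)" by (rule forces_mono[OF Imp.IH(1) meet2])
    with 2 m meet1 have "forces B \<rho> (meet \<gamma> ?A)" by simp
    then have "meet \<gamma> ?A \<preceq> (\<lambda>k. tr B True k \<rho>)" by (rule Imp.IH(4)[OF m])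
    then show ?case unfolding below_def meet_def tr.simps
      by eventually_elim (simp add: ent_impI) }
next
  case (All x A)
  { case 1
    have "forces A (\<rho>(x := t)) (\<lambda>k. tr (All x A) False k \<rho>)" for t
      by (rule forces_mono[OF All.IH(1)])
         (use all_inst[OF extensional_tr bvar_notin] in \<open>simp add: belowI del: fun_upd_apply\<close>)
    then show ?case by simp }
  { case 2
    then have "finite (\<Union>k. fv (\<gamma> k))" by (simp add: world_def fin_def)
    then obtain w where w: "w \<notin> (\<Union>k. fv (\<gamma> k)) \<union> used x A \<rho>"
      using fresh_nat[of "(\<Union>k. fv (\<gamma> k)) \<union> used x A \<rho>"] by auto
    \<comment> \<open>Forcing at all terms is used at \<open>w\<close> only: one threshold, beyond
      which \<open>w\<close> is generalized.\<close>
    have "\<gamma> \<preceq> (\<lambda>k. tr A True k (\<rho>(x := Var w)))" using 2 by (intro All.IH(2)) (simp_all del: fun_upd_apply)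
    then show ?case unfolding below_def tr.simps
      by eventually_elim (rule ent_all_fresh[OF extensional_tr bvar_notin]; use w in simp) }
next
  case (Ex x A)
  { case 1 show ?case
    proof (rule forces_ExI)
      fix \<delta> c
      assume \<delta>: "world \<delta>" "\<delta> \<preceq> (\<lambda>k. tr (Ex x A) False k \<rho>)" "fin c"
        and A: "\<And>t \<epsilon>. world \<epsilon> \<Longrightarrow> \<epsilon> \<preceq> \<delta> \<Longrightarrow> forces A (\<rho>(x := t)) \<epsilon> \<Longrightarrow> \<epsilon> \<preceq> c"
      have "finite (\<Union>k. fv (\<delta> k))" "finite (\<Union>k. fv (c k))" using \<delta> by (auto simp: world_def fin_def)
      then obtain w where w: "w \<notin> (\<Union>k. fv (\<delta> k)) \<union> (\<Union>k. fv (c k)) \<union> used x A \<rho>"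
        using fresh_nat[of "(\<Union>k. fv (\<delta> k)) \<union> (\<Union>k. fv (c k)) \<union> used x A \<rho>"] by auto
      have "meet \<delta> (\<lambda>k. tr A False k (\<rho>(x := Var w))) \<preceq> c"
        by (rule A[OF _ meet1 forces_mono[OF Ex.IH(1) meet2]]) (intro world_meet \<delta> world_tr)
      with \<delta>(2) show "\<delta> \<preceq> c" unfolding below_def meet_def
      proof eventually_elim
        case (elim k)
        have "Conj (\<delta> k) (tr (Ex x A) False k \<rho>) \<turnstile> c k"
          unfolding tr.simps
          by (rule ent_ex_fresh[OF extensional_tr bvar_notin _ _ _ elim(2)]) (use w in auto)
        with elim(1) show ?case by (meson ent_conjI ent_refl ent_trans)
      qed
    qed }
  { case 2 show ?case
    proof (rule forces_ExE[OF 2(2,1) below_refl fin_tr])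
      fix t \<epsilon> assume "world \<epsilon>" "forces A (\<rho>(x := t)) \<epsilon>"
      then have "\<epsilon> \<preceq> (\<lambda>k. tr A True k (\<rho>(x := t)))" by (rule Ex.IH(2))
      then show "\<epsilon> \<preceq> (\<lambda>k. tr (Ex x A) True k \<rho>)" unfolding tr.simps
        by (rule below_mono1[rotated]) (rule ex_inst[OF extensional_tr bvar_notin])
    qed }
next
  case (Box A)
  { case 1 show ?case using Box.IH(1) by simp }
  { case 2 then show ?case using Box.IH(2) by simp }
qed

section \<open>Soundness of the arithmetical axioms\<close>

lemma ent_iff_inst:
  assumes "CCpp (Iff A B)" "free_for t x A" "free_for t x B"
  shows "subst A x t \<turnstile> subst B x t" "subst B x t \<turnstile> subst A x t"
  using CCpp_subst[OF assms(1), of t x] assms(2,3) by (auto simp: Iff_def dest: CCpp_Iff[unfolded Iff_def])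

lemma Mem_Zero: "Mem t Zero \<turnstile> Box Bot"
  using ent_iff_inst(1)[OF CCpp.axiom[OF def_zero], of t rv]
  by (simp add: Bot_def rv_def)

lemma Mem_Sc:
  shows "Mem s (Sc t) \<turnstile> Box (Eq s t)" "Box (Eq s t) \<turnstile> Mem s (Sc t)"
proof -
  \<comment> \<open>Two single substitutions stand for a simultaneous one: \<open>x\<close> avoids
    \<open>s\<close>, so that the second leaves \<open>s\<close> alone.\<close>
  obtain x where x: "x \<noteq> rv" "x \<notin> tvars s" using fresh_nat[of "insert rv (tvars s)"] by auto
  have "CCpp (Iff (Mem s (Sc (Var x))) (Box (Eq s (Var x))))"
    using CCpp_subst[OF CCpp.axiom[OF def_S[OF x(1)]], of s rv] x by (simp add: Iff_def)
  from CCpp_subst[OF this, of t x] have "CCpp (Iff (Mem s (Sc t)) (Box (Eq s t)))"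
    using x by (simp add: Iff_def)
  then show "Mem s (Sc t) \<turnstile> Box (Eq s t)" "Box (Eq s t) \<turnstile> Mem s (Sc t)"
    by (rule CCpp_Iff)+
qed

lemma Sc_self: "H \<turnstile> Mem t (Sc t)"
  by (rule ent_trans[OF ent_trans[OF eqrefl_ent ent_box] Mem_Sc(2)])

text \<open>\<open>t\<close> is a member of \<open>Sc t\<close>, hence of \<open>Zero\<close>, whose
  definition yields falsity only under a box.\<close>

lemma Sc_eq_Zero: "Eq (Sc t) Zero \<turnstile> Box Bot"
  by (rule ent_trans[OF ent_mp[OF atom_eq_right(1) Sc_self] Mem_Zero])

text \<open>The member \<open>s\<close> of \<open>Sc s\<close> is moved into \<open>Sc t\<close>,
  whose definition returns the equation only under a box.\<close>

lemma Sc_inj: "Eq (Sc s) (Sc t) \<turnstile> Box (Eq s t)"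
  by (rule ent_trans[OF ent_mp[OF atom_eq_right(1) Sc_self] Mem_Sc(1)])

definition inductive_fm :: "nat \<Rightarrow> nat \<Rightarrow> fm" where
  "inductive_fm x z = Conj (Mem Zero (Var z)) (All x (Imp (Mem (Var x) (Var z)) (Mem (Sc (Var x)) (Var z))))"

lemma Mem_Omega:
  assumes "x \<noteq> rv" "z \<noteq> rv" "x \<noteq> z" "x \<notin> tvars t" "z \<notin> tvars t"
  shows "Mem t Omega \<turnstile> Box (All z (Imp (inductive_fm x z) (Mem t (Var z))))"
    and "Box (All z (Imp (inductive_fm x z) (Mem t (Var z)))) \<turnstile> Mem t Omega"
  using ent_iff_inst[OF CCpp.axiom[OF def_omega[OF assms(1-3)]], of t rv] assms
  by (auto simp: inductive_fm_def)

lemma Zero_in_Omega: "CCpp (Mem Zero Omega)"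
proof -
  have "CCpp (All 2 (Imp (inductive_fm 1 2) (Mem Zero (Var 2))))"
    by (intro CCpp_all) (simp add: inductive_fm_def ent_conj1 flip: ent_def)
  then have "CCpp (Box (All 2 (Imp (inductive_fm 1 2) (Mem Zero (Var 2)))))"
    by (rule CCpp_ent[OF ent_box])
  then show ?thesis by (rule CCpp_ent[OF Mem_Omega(2), rotated 5]) (auto simp: rv_def)
qed

text \<open>Both memberships unfold to boxed formulas, so the usual argument runs under the box by
  \<open>box_mono\<close> and costs no additional box.\<close>

lemma Sc_in_Omega: "Mem t Omega \<turnstile> Mem (Sc t) Omega"
proof -
  obtain x where x: "x \<noteq> rv" "x \<notin> tvars t" using fresh_nat[of "insert rv (tvars t)"] by auto
  obtain z where z: "z \<noteq> rv" "x \<noteq> z" "z \<notin> tvars t" using fresh_nat[of "{rv, x} \<union> tvars t"] by auto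
  let ?I = "inductive_fm x z"
  let ?A = "All z (Imp ?I (Mem t (Var z)))"
  have "?A \<turnstile> Imp ?I (Mem t (Var z))"
    using ent_allE[of "Var z" z "Imp ?I (Mem t (Var z))"] by simp
  then have t: "Conj ?A ?I \<turnstile> Mem t (Var z)" by (rule ent_impE)
  have "?I \<turnstile> All x (Imp (Mem (Var x) (Var z)) (Mem (Sc (Var x)) (Var z)))"
    unfolding inductive_fm_def by (rule ent_conj2)
  also have "\<dots> \<turnstile> Imp (Mem t (Var z)) (Mem (Sc t) (Var z))"
    using ent_allE[of t x "Imp (Mem (Var x) (Var z)) (Mem (Sc (Var x)) (Var z))"] z by simp
  finally have "Conj ?A ?I \<turnstile> Mem (Sc t) (Var z)"
    using t by (meson ent_conj2 ent_mp ent_trans)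
  then have "?A \<turnstile> All z (Imp ?I (Mem (Sc t) (Var z)))" by (intro ent_allI ent_impI) auto
  then have "Box ?A \<turnstile> Box (All z (Imp ?I (Mem (Sc t) (Var z))))" by (rule box_mono)
  moreover have "Mem t Omega \<turnstile> Box ?A" using x z by (intro Mem_Omega) auto
  moreover have "Box (All z (Imp ?I (Mem (Sc t) (Var z)))) \<turnstile> Mem (Sc t) Omega"
    using x z by (intro Mem_Omega) auto
  ultimately show ?thesis by (meson ent_trans)
qed

text \<open>Entry \<open>k\<close> pays for entry \<open>k + 1\<close>:
  \<open>\<gamma> (Suc k)\<close> entails \<open>\<gamma> k\<close>, hence \<open>boxn k A\<close>,
  hence \<open>boxn k (Box B)\<close>, which is \<open>boxn (Suc k) B\<close>.\<close>

lemma below_box_absorb: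
  assumes "A \<turnstile> Box B" "world \<gamma>" "\<gamma> \<preceq> (\<lambda>k. boxn k A)"
  shows "\<gamma> \<preceq> (\<lambda>k. boxn k B)"
proof -
  have "\<forall>\<^sub>F k in sequentially. \<gamma> k \<turnstile> boxn k A" using assms(3) by (simp add: below_def)
  then have "\<forall>\<^sub>F k in sequentially. \<gamma> (Suc k) \<turnstile> boxn (Suc k) B"
  proof eventually_elim
    case (elim k)
    have "\<gamma> (Suc k) \<turnstile> \<gamma> k" using assms(2) by (simp add: world_def)
    also note elim
    also note boxn_mono[OF assms(1)]
    finally show ?case by (simp only: boxn_Suc')
  qed
  then show ?thesis unfolding below_def
    by (subst (asm) eventually_sequentially_Suc[of "\<lambda>k. \<gamma> k \<turnstile> boxn k B"])
qed

lemma forces_paax: "paax A \<Longrightarrow> world \<gamma> \<Longrightarrow> forces A \<rho> \<gamma>"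
proof (induction rule: paax.induct)
  case zero_nat
  show ?case by (simp add: belowI ent_trans[OF ent_thm[OF Zero_in_Omega] ent_boxn])
next
  case (succ_nat x)
  show ?case by (auto intro: below_mono1[OF boxn_mono[OF Sc_in_Omega]])
next
  case (succ_ne_zero x)
  show ?case unfolding Neg_def by (auto intro!: forces_efq intro: below_box_absorb[OF Sc_eq_Zero])
next
  case (succ_inj x y)
  show ?case by (auto intro: below_box_absorb[OF Sc_inj])
qed

section \<open>Soundness of the whole theory, and conclusion\<close>

lemma forces_PAmi: "PAmi A \<Longrightarrow> world \<gamma> \<Longrightarrow> forces A \<rho> \<gamma>"
proof (induction arbitrary: \<rho> \<gamma> rule: PAmi.induct)
  case (logic A)
  then show ?case by (simp add: forces_logax)
next
  case (axiom A)
  then show ?case by (simp add: forces_paax)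
next
  case (mp A B)
  \<comment> \<open>Cut costs nothing in the model: the implication is applied at the world
    \<open>\<gamma>\<close> itself.\<close>
  then show ?case by (metis below_refl forces.simps(5))
next
  case (allR B A x)
  have "forces A (\<rho>(x := t)) \<delta>" if "world \<delta>" "\<delta> \<preceq> \<gamma>" "forces B \<rho> \<delta>" for \<delta> t
  proof -
    have "forces B (\<rho>(x := t)) \<delta> = forces B \<rho> \<delta>" using allR.hyps(2) by (intro forces_cong) auto
    with allR.IH[OF that(1), of "\<rho>(x := t)"] that show ?thesis by (simp del: fun_upd_apply)
  qed
  then show ?case by simp
next
  case (exR A B x)
  have "forces B \<rho> \<delta>" if \<delta>: "world \<delta>" "forces (Ex x A) \<rho> \<delta>" for \<delta>
  proof (rule forces_run[OF \<delta>(1)])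
    fix \<epsilon> c
    assume *: "world \<epsilon>" "\<epsilon> \<preceq> \<delta>" "fin c"
      "\<And>\<zeta>. world \<zeta> \<Longrightarrow> \<zeta> \<preceq> \<epsilon> \<Longrightarrow> forces B \<rho> \<zeta> \<Longrightarrow> \<zeta> \<preceq> c"
    show "\<epsilon> \<preceq> c"
    proof (rule forces_ExE[OF \<delta>(2) *(1-3)])
      fix t \<zeta> assume \<zeta>: "world \<zeta>" "\<zeta> \<preceq> \<epsilon>" "forces A (\<rho>(x := t)) \<zeta>"
      have "forces B (\<rho>(x := t)) \<zeta> = forces B \<rho> \<zeta>" using exR.hyps(2) by (intro forces_cong) auto
      with exR.IH[OF \<zeta>(1), of "\<rho>(x := t)"] \<zeta> *(4) show "\<zeta> \<preceq> c" by (simp del: fun_upd_apply)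
    qed
  qed
  then show ?case by simp
qed

text \<open>Erasing a translation returns \<open>erase \<phi>\<close>, which is
  \<open>\<phi>\<close> itself only if \<open>\<phi>\<close> has no boxes.\<close>

lemma PAmi_boxfree: "PAmi A \<Longrightarrow> boxfree A"
proof (induction rule: PAmi.induct)
  case (axiom A)
  then show ?case by cases (auto simp: Neg_def Bot_def)
qed auto

lemma erase_boxfree: "boxfree A \<Longrightarrow> erase A = A"
  by (induction A) auto

theorem theorem6p2:
  shows "weakly_interprets CCpp PAmi"
  unfolding weakly_interprets_def
proof (intro allI impI)
  fix \<phi> assume \<phi>: "PAmi \<phi>"
  \<comment> \<open>A closed theorem at every index plays the empty context; any \<open>k\<close>
    past the threshold then serves.\<close>
  let ?\<gamma> = "\<lambda>k :: nat. Eq Zero Zero"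
  have "world ?\<gamma>" by (simp add: world_def fin_def)
  then have "?\<gamma> \<preceq> (\<lambda>k. tr \<phi> True k Var)" using \<phi> by (intro forces_imp_tr forces_PAmi)
  then obtain k where "Eq Zero Zero \<turnstile> tr \<phi> True k Var"
    unfolding below_def by (meson eventually_sequentially order_refl)
  then have "CCpp (tr \<phi> True k Var)" by (rule CCpp_ent) (intro CCpp.logic eqrefl)
  then show "\<exists>\<psi>. CCpp \<psi> \<and> erase \<psi> = \<phi>"
    using erase_tr_Var erase_boxfree PAmi_boxfree \<phi> by metis
qed

end
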